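(* Let $n\ge 1$. Both $Q_n$ and its set complement $Q'_n=\mathcal{PC}_n\setminus Q_n$ are subsemigroups of $\mathcal{PC}_n$. Moreover, $Q_n\cdot Q'_n=Q'_n\cdot Q_n=Q'_n$.
   Context: Let $X_n=\{1,2,\ldots,n\}$ with its natural order. A partial transformation of $X_n$ is a map $\alpha:\mathrm{Dom}\,\alpha\to X_n$ with $\mathrm{Dom}\,\alpha\subseteq X_n$ (the empty map is allowed); maps are written on the right, so $x(\alpha\beta)=(x\alpha)\beta$, defined when $x\in\mathrm{Dom}\,\alpha$ and $x\alpha\in\mathrm{Dom}\,\beta$. A partial transformation is decreasing if $x\alpha\le x$ for all $x\in\mathrm{Dom}\,\alpha$, and order-preserving if $x\le y$ implies $x\alpha\le y\alpha$ for all $x,y\in\mathrm{Dom}\,\alpha$. $\mathcal{PC}_n$ is the semigroup, under composition, of all decreasing and order-preserving partial transformations of $X_n$, and $Q_n=\{\alpha\in\mathcal{PC}_n:1\in\mathrm{Dom}\,\alpha\}$. For subsets $A,B$ of a semigroup, $A\cdot B=\{ab:a\in A,\ b\in B\}$. *)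

theory Defs
  imports "HOL-Algebra.Coset"
begin

definition chain :: "nat \<Rightarrow> nat set" where
  "chain n = {1..n}"

definition partial_transformations :: "nat \<Rightarrow> (nat \<rightharpoonup> nat) set" where
  "partial_transformations n = {\<alpha>. dom \<alpha> \<subseteq> chain n \<and> ran \<alpha> \<subseteq> chain n}"

definition decreasing :: "(nat \<rightharpoonup> nat) \<Rightarrow> bool" where
  "decreasing \<alpha> \<longleftrightarrow> (\<forall>x\<in>dom \<alpha>. the (\<alpha> x) \<le> x)"

definition order_preserving :: "(nat \<rightharpoonup> nat) \<Rightarrow> bool" where
  "order_preserving \<alpha> \<longleftrightarrow> mono_on (dom \<alpha>) (\<lambda>x. the (\<alpha> x))"

text \<open>Maps are written on the right: the product of \<open>\<alpha>\<close> and \<open>\<beta>\<close> applies \<open>\<alpha>\<close> first,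
  whereas \<open>\<circ>\<^sub>m\<close> applies its right argument first. The unit is only there because
  the record type demands one.\<close>

definition PC :: "nat \<Rightarrow> (nat \<rightharpoonup> nat) monoid" where
  "PC n = \<lparr>carrier = {\<alpha> \<in> partial_transformations n. decreasing \<alpha> \<and> order_preserving \<alpha>},
           mult = (\<lambda>\<alpha> \<beta>. \<beta> \<circ>\<^sub>m \<alpha>),
           one = Some |` chain n\<rparr>"

definition Q :: "nat \<Rightarrow> (nat \<rightharpoonup> nat) set" where
  "Q n = {\<alpha> \<in> carrier (PC n). 1 \<in> dom \<alpha>}"

definition Q' :: "nat \<Rightarrow> (nat \<rightharpoonup> nat) set" where
  "Q' n = carrier (PC n) - Q n"

text \<open>Unlike \<^const>\<open>submonoid\<close>, this does not ask for the unit; subsemigroups are nonempty.\<close>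

definition subsemigroup :: "'a set \<Rightarrow> ('a, 'b) monoid_scheme \<Rightarrow> bool" where
  "subsemigroup H G \<longleftrightarrow>
     H \<noteq> {} \<and> H \<subseteq> carrier G \<and> (\<forall>x\<in>H. \<forall>y\<in>H. x \<otimes>\<^bsub>G\<^esub> y \<in> H)"

lemma PC_carrier_iff:
  "\<alpha> \<in> carrier (PC n) \<longleftrightarrow>
     (\<forall>x y. \<alpha> x = Some y \<longrightarrow> x \<in> chain n \<and> y \<in> chain n \<and> y \<le> x) \<and>
     (\<forall>x y u v. \<alpha> x = Some u \<longrightarrow> \<alpha> y = Some v \<longrightarrow> x \<le> y \<longrightarrow> u \<le> v)"
  unfolding PC_def partial_transformations_def decreasing_def order_preserving_def
    mono_on_def dom_def ran_def subset_iff
  by (simp del: not_None_eq) (fastforce simp del: not_None_eq)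

lemma PC_monoid: "monoid (PC n)"
proof (rule monoidI)
  show "\<alpha> \<otimes>\<^bsub>PC n\<^esub> \<beta> \<in> carrier (PC n)"
    if "\<alpha> \<in> carrier (PC n)" "\<beta> \<in> carrier (PC n)" for \<alpha> \<beta>
  proof -
    have "\<alpha> \<otimes>\<^bsub>PC n\<^esub> \<beta> = \<beta> \<circ>\<^sub>m \<alpha>" by (simp add: PC_def)
    with that show ?thesis
      unfolding PC_carrier_iff by (simp add: map_comp_Some_iff) (meson le_trans)
  qed
  show "\<one>\<^bsub>PC n\<^esub> \<in> carrier (PC n)"
    unfolding PC_carrier_iff by (simp add: PC_def restrict_map_def)
  show "\<alpha> \<otimes>\<^bsub>PC n\<^esub> \<beta> \<otimes>\<^bsub>PC n\<^esub> \<gamma> = \<alpha> \<otimes>\<^bsub>PC n\<^esub> (\<beta> \<otimes>\<^bsub>PC n\<^esub> \<gamma>)" for \<alpha> \<beta> \<gamma>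
    by (auto simp: PC_def map_comp_def fun_eq_iff split: option.splits)
  show "\<one>\<^bsub>PC n\<^esub> \<otimes>\<^bsub>PC n\<^esub> \<alpha> = \<alpha>" if "\<alpha> \<in> carrier (PC n)" for \<alpha>
  proof -
    have "\<alpha> x = None" if "x \<notin> chain n" for x
      using that \<open>\<alpha> \<in> carrier (PC n)\<close> unfolding PC_carrier_iff by (cases "\<alpha> x") auto
    then show ?thesis
      by (auto simp: PC_def map_comp_def restrict_map_def fun_eq_iff)
  qed
  show "\<alpha> \<otimes>\<^bsub>PC n\<^esub> \<one>\<^bsub>PC n\<^esub> = \<alpha>" if "\<alpha> \<in> carrier (PC n)" for \<alpha>
  proof
    fix x
    show "(\<alpha> \<otimes>\<^bsub>PC n\<^esub> \<one>\<^bsub>PC n\<^esub>) x = \<alpha> x"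
      using that unfolding PC_carrier_iff
      by (cases "\<alpha> x") (auto simp: PC_def map_comp_def restrict_map_def)
  qed
qed

end

theory Submission
  imports Defs
begin

text \<open>
  The point \<open>1\<close> is the minimum of the chain, so a decreasing map that is defined at \<open>1\<close> must
  fix it. Hence a product of two elements of \<^term>\<open>PC n\<close> is defined at \<open>1\<close> exactly when both
  factors are (\<open>mult_mem_Q_iff\<close>). In other words, membership in \<^term>\<open>Q n\<close> is a homomorphism
  from \<^term>\<open>PC n\<close> to the two-element semilattice of truth values under conjunction: the elements
  mapped to true form a subsemigroup, and those mapped to false form an ideal. The ideal
  \<^term>\<open>Q' n\<close> therefore absorbs products with \<^term>\<open>Q n\<close> from either side, and these products
  exhaust it because the identity map lies in \<^term>\<open>Q n\<close>.
\<close>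

lemma PC_maps_1_to_1:
  assumes "\<alpha> \<in> carrier (PC n)" and "\<alpha> 1 = Some y"
  shows "y = 1"
proof -
  have "y \<in> chain n" and "y \<le> 1"
    using assms unfolding PC_carrier_iff by blast+
  then show ?thesis
    by (simp add: chain_def)
qed

text \<open>Since the first factor can only send \<open>1\<close> to itself, the second factor is asked for its value
  at \<open>1\<close> again.\<close>

lemma mult_mem_Q_iff:
  assumes "\<alpha> \<in> carrier (PC n)" and "\<beta> \<in> carrier (PC n)"
  shows "\<alpha> \<otimes>\<^bsub>PC n\<^esub> \<beta> \<in> Q n \<longleftrightarrow> \<alpha> \<in> Q n \<and> \<beta> \<in> Q n"
proof -
  have "1 \<in> dom (\<beta> \<circ>\<^sub>m \<alpha>) \<longleftrightarrow> 1 \<in> dom \<alpha> \<and> 1 \<in> dom \<beta>"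
    using PC_maps_1_to_1[OF assms(1)] by (cases "\<alpha> 1") (auto simp: dom_def map_comp_def)
  moreover have "\<alpha> \<otimes>\<^bsub>PC n\<^esub> \<beta> = \<beta> \<circ>\<^sub>m \<alpha>"
    by (simp add: PC_def)
  moreover have "\<alpha> \<otimes>\<^bsub>PC n\<^esub> \<beta> \<in> carrier (PC n)"
    using monoid.m_closed[OF PC_monoid assms] .
  ultimately show ?thesis
    using assms unfolding Q_def by simp
qed

lemma one_mem_Q:
  assumes "n \<ge> 1"
  shows "\<one>\<^bsub>PC n\<^esub> \<in> Q n"
proof -
  have "1 \<in> dom \<one>\<^bsub>PC n\<^esub>"
    using assms by (simp add: PC_def chain_def)
  then show ?thesis
    using monoid.one_closed[OF PC_monoid] by (simp add: Q_def)
qed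

lemma empty_mem_Q': "Map.empty \<in> Q' n"
  by (simp add: Q'_def Q_def PC_carrier_iff)

theorem lemma2p1:
  fixes n :: nat
  assumes "n \<ge> 1"
  shows "subsemigroup (Q n) (PC n) \<and> subsemigroup (Q' n) (PC n) \<and>
         Q n <#>\<^bsub>PC n\<^esub> Q' n = Q' n \<and> Q' n <#>\<^bsub>PC n\<^esub> Q n = Q' n"
proof (intro conjI)
  interpret monoid "PC n"
    by (rule PC_monoid)
  have Q_sub: "Q n \<subseteq> carrier (PC n)" and Q'_sub: "Q' n \<subseteq> carrier (PC n)"
    by (auto simp: Q_def Q'_def)
  have absorb: "\<alpha> \<otimes>\<^bsub>PC n\<^esub> \<beta> \<in> Q' n"
    if "\<alpha> \<in> carrier (PC n)" "\<beta> \<in> carrier (PC n)" "\<alpha> \<in> Q' n \<or> \<beta> \<in> Q' n" for \<alpha> \<beta>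
    using that by (auto simp: Q'_def mult_mem_Q_iff)
  show "subsemigroup (Q n) (PC n)"
    unfolding subsemigroup_def
    using Q_sub one_mem_Q[OF assms] by (auto simp: mult_mem_Q_iff subset_iff)
  show "subsemigroup (Q' n) (PC n)"
    unfolding subsemigroup_def
    using Q'_sub empty_mem_Q' absorb by blast
  show "Q n <#>\<^bsub>PC n\<^esub> Q' n = Q' n"
  proof
    show "Q n <#>\<^bsub>PC n\<^esub> Q' n \<subseteq> Q' n"
      using absorb Q_sub Q'_sub unfolding set_mult_def by blast
    show "Q' n \<subseteq> Q n <#>\<^bsub>PC n\<^esub> Q' n"
    proof
      fix \<alpha> assume "\<alpha> \<in> Q' n"
      moreover from this have "\<alpha> = \<one>\<^bsub>PC n\<^esub> \<otimes>\<^bsub>PC n\<^esub> \<alpha>"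
        using Q'_sub by auto
      ultimately show "\<alpha> \<in> Q n <#>\<^bsub>PC n\<^esub> Q' n"
        using one_mem_Q[OF assms] unfolding set_mult_def by blast
    qed
  qed
  show "Q' n <#>\<^bsub>PC n\<^esub> Q n = Q' n"
  proof
    show "Q' n <#>\<^bsub>PC n\<^esub> Q n \<subseteq> Q' n"
      using absorb Q_sub Q'_sub unfolding set_mult_def by blast
    show "Q' n \<subseteq> Q' n <#>\<^bsub>PC n\<^esub> Q n"
    proof
      fix \<alpha> assume "\<alpha> \<in> Q' n"
      moreover from this have "\<alpha> = \<alpha> \<otimes>\<^bsub>PC n\<^esub> \<one>\<^bsub>PC n\<^esub>"
        using Q'_sub by auto
      ultimately show "\<alpha> \<in> Q' n <#>\<^bsub>PC n\<^esub> Q n"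
        using one_mem_Q[OF assms] unfolding set_mult_def by blast
    qed
  qed
qed

end
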